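(* Let $(L,\cdot)$ be a quasigroup (respectively, a loop) with holomorph $H(L)$. Then $H(L)$ is a CIPQ (respectively, a CIPL) if and only if $AUM(L)$ is an abelian group and any one of the following is true for all $x,y\in L$ and all $\alpha,\beta\in AUM(L)$: 1. $(x\beta\cdot y)x^\rho=y\alpha$; 2. $x\beta\cdot yx^\rho=y\alpha$; 3. $(x^\lambda\alpha^{-1}\beta\alpha\cdot y\alpha)\cdot x=y$; 4. $x^\lambda\alpha^{-1}\beta\alpha\cdot(y\alpha\cdot x)=y$.
   Context: Mappings are written on the right of their arguments and composed from left to right. A quasigroup $(L,\cdot)$ is a non-empty set with a binary operation such that for all $a,b\in L$ the equations $a\cdot x=b$ and $y\cdot a=b$ have unique solutions $x,y\in L$; a loop is a quasigroup with a two-sided identity element $e$. For $x\in L$, the right inverse $x^\rho$ and left inverse $x^\lambda$ are the elements with $x x^\rho=e^\rho$ and $x^\lambda x=e^\lambda$, where $e^\rho$ and $e^\lambda$ denote a right identity element and a left identity element of $L$ (assumed to exist whenever $x^\rho$, respectively $x^\lambda$, is used; both equal $e$ in a loop). $AUM(L)$ is the automorphism group of $(L,\cdot)$. The holomorph $H(L)=(H,\circ)$ is the set $H$ of pairs $(\alpha,x)$, $\alpha\in AUM(L)$, $x\in L$, with operation $(\alpha,x)\circ(\beta,y)=(\alpha\beta,\,x\beta\cdot y)$. A quasigroup (loop) is a cross inverse property quasigroup, CIPQ (loop, CIPL), if and only if it obeys one of the (equivalent) identities $xy\cdot x^\rho=y$, or $x\cdot yx^\rho=y$, or $x^\lambda\cdot(yx)=y$,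 or $x^\lambda y\cdot x=y$. Juxtaposition of elements binds more tightly than $\cdot$; an element followed by maps (such as $x^\lambda\alpha^{-1}\beta\alpha$) denotes the image of the element under the maps applied from left to right. *)

theory Defs
  imports "HOL-Algebra.Bij"
begin

text \<open>
  A set with a binary operation is represented by the carrier and multiplication of a
  \<^type>\<open>monoid_scheme\<close> record, so that the library notions of homomorphism, automorphism and
  automorphism group apply. The field \<^const>\<open>one\<close> of the record plays no role below: a quasigroup
  need not have an identity, and identity elements are always characterised by their property.
\<close>

definition quasigroup :: "('a, 'b) monoid_scheme \<Rightarrow> bool" where
  "quasigroup L \<longleftrightarrow>
     carrier L \<noteq> {} \<and>
     (\<forall>a\<in>carrier L. \<forall>b\<in>carrier L. a \<otimes>\<^bsub>L\<^esub> b \<in> carrier L) \<and>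
     (\<forall>a\<in>carrier L. \<forall>b\<in>carrier L. \<exists>!x. x \<in> carrier L \<and> a \<otimes>\<^bsub>L\<^esub> x = b) \<and>
     (\<forall>a\<in>carrier L. \<forall>b\<in>carrier L. \<exists>!y. y \<in> carrier L \<and> y \<otimes>\<^bsub>L\<^esub> a = b)"

definition right_identity :: "('a, 'b) monoid_scheme \<Rightarrow> 'a \<Rightarrow> bool" where
  "right_identity L e \<longleftrightarrow> e \<in> carrier L \<and> (\<forall>x\<in>carrier L. x \<otimes>\<^bsub>L\<^esub> e = x)"

definition left_identity :: "('a, 'b) monoid_scheme \<Rightarrow> 'a \<Rightarrow> bool" where
  "left_identity L e \<longleftrightarrow> e \<in> carrier L \<and> (\<forall>x\<in>carrier L. e \<otimes>\<^bsub>L\<^esub> x = x)"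

definition quasigroup_loop :: "('a, 'b) monoid_scheme \<Rightarrow> bool" where
  "quasigroup_loop L \<longleftrightarrow> quasigroup L \<and> (\<exists>e. right_identity L e \<and> left_identity L e)"

text \<open>
  In a quasigroup a one-sided identity is unique if it exists, and so are then the corresponding
  one-sided inverses; the descriptions below are meaningful only when it exists.
\<close>

definition right_id :: "('a, 'b) monoid_scheme \<Rightarrow> 'a" where
  "right_id L = (THE e. right_identity L e)"

definition left_id :: "('a, 'b) monoid_scheme \<Rightarrow> 'a" where
  "left_id L = (THE e. left_identity L e)"

definition right_inv :: "('a, 'b) monoid_scheme \<Rightarrow> 'a \<Rightarrow> 'a" where
  "right_inv L x = (THE y. y \<in> carrier L \<and> x \<otimes>\<^bsub>L\<^esub> y = right_id L)"

definition left_inv :: "('a, 'b) monoid_scheme \<Rightarrow> 'a \<Rightarrow> 'a" where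
  "left_inv L x = (THE y. y \<in> carrier L \<and> y \<otimes>\<^bsub>L\<^esub> x = left_id L)"

text \<open>
  The four cross inverse identities. Each includes the existence of the one-sided identity
  needed for the one-sided inverse occurring in it to be defined.
\<close>

definition cross_inverse1 :: "('a, 'b) monoid_scheme \<Rightarrow> bool" where
  "cross_inverse1 L \<longleftrightarrow> (\<exists>e. right_identity L e) \<and>
     (\<forall>x\<in>carrier L. \<forall>y\<in>carrier L. (x \<otimes>\<^bsub>L\<^esub> y) \<otimes>\<^bsub>L\<^esub> right_inv L x = y)"

definition cross_inverse2 :: "('a, 'b) monoid_scheme \<Rightarrow> bool" where
  "cross_inverse2 L \<longleftrightarrow> (\<exists>e. right_identity L e) \<and>
     (\<forall>x\<in>carrier L. \<forall>y\<in>carrier L. x \<otimes>\<^bsub>L\<^esub> (y \<otimes>\<^bsub>L\<^esub> right_inv L x) = y)"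

definition cross_inverse3 :: "('a, 'b) monoid_scheme \<Rightarrow> bool" where
  "cross_inverse3 L \<longleftrightarrow> (\<exists>e. left_identity L e) \<and>
     (\<forall>x\<in>carrier L. \<forall>y\<in>carrier L. left_inv L x \<otimes>\<^bsub>L\<^esub> (y \<otimes>\<^bsub>L\<^esub> x) = y)"

definition cross_inverse4 :: "('a, 'b) monoid_scheme \<Rightarrow> bool" where
  "cross_inverse4 L \<longleftrightarrow> (\<exists>e. left_identity L e) \<and>
     (\<forall>x\<in>carrier L. \<forall>y\<in>carrier L. (left_inv L x \<otimes>\<^bsub>L\<^esub> y) \<otimes>\<^bsub>L\<^esub> x = y)"

definition CIPQ :: "('a, 'b) monoid_scheme \<Rightarrow> bool" where
  "CIPQ L \<longleftrightarrow> quasigroup L \<and>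
     (cross_inverse1 L \<or> cross_inverse2 L \<or> cross_inverse3 L \<or> cross_inverse4 L)"

definition CIPL :: "('a, 'b) monoid_scheme \<Rightarrow> bool" where
  "CIPL L \<longleftrightarrow> quasigroup_loop L \<and>
     (cross_inverse1 L \<or> cross_inverse2 L \<or> cross_inverse3 L \<or> cross_inverse4 L)"

text \<open>
  Maps are written on the right and composed from left to right, so the product of \<open>\<alpha>\<close> and \<open>\<beta>\<close>
  is ``first \<open>\<alpha>\<close>, then \<open>\<beta>\<close>'', whereas \<^const>\<open>AutoGroup\<close> composes from right to left.
\<close>

definition AUM :: "('a, 'b) monoid_scheme \<Rightarrow> ('a \<Rightarrow> 'a) monoid" where
  "AUM L = AutoGroup L \<lparr>mult := \<lambda>\<alpha> \<beta>. \<beta> \<otimes>\<^bsub>AutoGroup L\<^esub> \<alpha>\<rparr>"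

text \<open>
  The image of \<open>x\<close> under \<open>\<beta>\<close> is the function application \<open>\<beta> x\<close>.
\<close>

definition holomorph :: "('a, 'b) monoid_scheme \<Rightarrow> (('a \<Rightarrow> 'a) \<times> 'a) monoid" where
  "holomorph L =
     \<lparr>carrier = carrier (AUM L) \<times> carrier L,
      mult = \<lambda>(\<alpha>, x) (\<beta>, y). (\<alpha> \<otimes>\<^bsub>AUM L\<^esub> \<beta>, \<beta> x \<otimes>\<^bsub>L\<^esub> y),
      one = (\<one>\<^bsub>AUM L\<^esub>, \<one>\<^bsub>L\<^esub>)\<rparr>"

text \<open>
  The four conditions on \<open>L\<close> characterising when its holomorph has the cross inverse property;
  again each includes the existence of the one-sided identity it presupposes (automatic in a loop).
\<close>

definition holomorph_cond1 :: "('a, 'b) monoid_scheme \<Rightarrow> bool" where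
  "holomorph_cond1 L \<longleftrightarrow> (\<exists>e. right_identity L e) \<and>
     (\<forall>x\<in>carrier L. \<forall>y\<in>carrier L. \<forall>\<alpha>\<in>carrier (AUM L). \<forall>\<beta>\<in>carrier (AUM L).
        (\<beta> x \<otimes>\<^bsub>L\<^esub> y) \<otimes>\<^bsub>L\<^esub> right_inv L x = \<alpha> y)"

definition holomorph_cond2 :: "('a, 'b) monoid_scheme \<Rightarrow> bool" where
  "holomorph_cond2 L \<longleftrightarrow> (\<exists>e. right_identity L e) \<and>
     (\<forall>x\<in>carrier L. \<forall>y\<in>carrier L. \<forall>\<alpha>\<in>carrier (AUM L). \<forall>\<beta>\<in>carrier (AUM L).
        \<beta> x \<otimes>\<^bsub>L\<^esub> (y \<otimes>\<^bsub>L\<^esub> right_inv L x) = \<alpha> y)"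

definition holomorph_cond3 :: "('a, 'b) monoid_scheme \<Rightarrow> bool" where
  "holomorph_cond3 L \<longleftrightarrow> (\<exists>e. left_identity L e) \<and>
     (\<forall>x\<in>carrier L. \<forall>y\<in>carrier L. \<forall>\<alpha>\<in>carrier (AUM L). \<forall>\<beta>\<in>carrier (AUM L).
        (\<alpha> (\<beta> ((inv\<^bsub>AUM L\<^esub> \<alpha>) (left_inv L x))) \<otimes>\<^bsub>L\<^esub> \<alpha> y) \<otimes>\<^bsub>L\<^esub> x = y)"

definition holomorph_cond4 :: "('a, 'b) monoid_scheme \<Rightarrow> bool" where
  "holomorph_cond4 L \<longleftrightarrow> (\<exists>e. left_identity L e) \<and>
     (\<forall>x\<in>carrier L. \<forall>y\<in>carrier L. \<forall>\<alpha>\<in>carrier (AUM L). \<forall>\<beta>\<in>carrier (AUM L).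
        \<alpha> (\<beta> ((inv\<^bsub>AUM L\<^esub> \<alpha>) (left_inv L x))) \<otimes>\<^bsub>L\<^esub> (\<alpha> y \<otimes>\<^bsub>L\<^esub> x) = y)"

end

theory Submission
  imports Defs
begin

text \<open>
  Every condition in the equivalence says the same two things: \<open>L\<close> has no automorphism other than
  the identity, and \<open>L\<close> itself is a cross inverse property loop.

  For the conditions on \<open>L\<close>, the reason is that an automorphism occurs on one side of the equation
  only. In the first two, the left-hand side does not mention \<open>\<alpha>\<close>, so \<open>\<alpha> y\<close> cannot vary with \<open>\<alpha>\<close>;
  in the last two, put \<open>\<alpha> = 1\<close>, cancel, and find that \<open>\<beta>\<close> fixes every left inverse, hence every
  element. With only the identity automorphism left, they become the four cross inverse identities
  of \<open>L\<close>.

  For the holomorph, let \<open>e\<close> be the identity of \<open>L\<close> and let \<open>(\<alpha>', z)\<close> be the right inverse of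
  \<open>(\<alpha>, e)\<close>. The identity \<open>(XY)X\<^sup>\<rho> = Y\<close> for \<open>X = (\<alpha>, e)\<close> and \<open>Y = (1, y)\<close> forces \<open>\<alpha>' y = y\<close>, so
  \<open>\<alpha>' = 1\<close> and \<open>\<alpha> = 1\<close>. Once the automorphism group is trivial, the holomorph is a copy of \<open>L\<close>.

  The four cross inverse identities are equivalent even for quasigroups with a one-sided identity:
  evaluated at \<open>x = e\<close>, each makes \<open>e\<close> two-sided, so that a CIPQ is always a loop. Written as
  statements about pairs with \<open>x x' = e\<close>, the identities for left inverses are then those for right
  inverses with the roles of the pair exchanged, and the two that remain say that left
  multiplication by \<open>x\<close> and right multiplication by \<open>x'\<close> are inverse to each other, in either order.
\<close>

section \<open>Quasigroups and one-sided inverses\<close>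

lemma quasigroup_closed:
  "quasigroup L \<Longrightarrow> a \<in> carrier L \<Longrightarrow> b \<in> carrier L \<Longrightarrow> a \<otimes>\<^bsub>L\<^esub> b \<in> carrier L"
  unfolding quasigroup_def by (elim conjE) (drule (1) bspec, drule (1) bspec)

lemma quasigroup_ex1_left_division:
  assumes "quasigroup L" "a \<in> carrier L" "b \<in> carrier L"
  shows "\<exists>!x. x \<in> carrier L \<and> a \<otimes>\<^bsub>L\<^esub> x = b"
proof -
  from assms(1) have "\<forall>a\<in>carrier L. \<forall>b\<in>carrier L. \<exists>!x. x \<in> carrier L \<and> a \<otimes>\<^bsub>L\<^esub> x = b"
    unfolding quasigroup_def by (elim conjE)
  from bspec[OF bspec[OF this assms(2)] assms(3)] show ?thesis .
qed

lemma quasigroup_ex1_right_division: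
  assumes "quasigroup L" "a \<in> carrier L" "b \<in> carrier L"
  shows "\<exists>!y. y \<in> carrier L \<and> y \<otimes>\<^bsub>L\<^esub> a = b"
proof -
  from assms(1) have "\<forall>a\<in>carrier L. \<forall>b\<in>carrier L. \<exists>!y. y \<in> carrier L \<and> y \<otimes>\<^bsub>L\<^esub> a = b"
    unfolding quasigroup_def by (elim conjE)
  from bspec[OF bspec[OF this assms(2)] assms(3)] show ?thesis .
qed

lemma quasigroup_left_cancel:
  assumes "quasigroup L" "a \<in> carrier L" "x \<in> carrier L" "y \<in> carrier L"
    and "a \<otimes>\<^bsub>L\<^esub> x = a \<otimes>\<^bsub>L\<^esub> y"
  shows "x = y"
proof -
  note unique = the1_equality[OF quasigroup_ex1_left_division[OF assms(1,2) quasigroup_closed[OF assms(1,2,4)]]]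
  show ?thesis by (rule trans[OF unique[symmetric] unique]) (simp_all add: assms)
qed

lemma quasigroup_right_cancel:
  assumes "quasigroup L" "a \<in> carrier L" "x \<in> carrier L" "y \<in> carrier L"
    and "x \<otimes>\<^bsub>L\<^esub> a = y \<otimes>\<^bsub>L\<^esub> a"
  shows "x = y"
proof -
  note unique = the1_equality[OF quasigroup_ex1_right_division[OF assms(1,2) quasigroup_closed[OF assms(1,4,2)]]]
  show ?thesis by (rule trans[OF unique[symmetric] unique]) (simp_all add: assms)
qed

lemma quasigroup_left_division:
  assumes "quasigroup L" "a \<in> carrier L" "b \<in> carrier L"
  obtains x where "x \<in> carrier L" "a \<otimes>\<^bsub>L\<^esub> x = b"
  using ex1_implies_ex[OF quasigroup_ex1_left_division[OF assms]] by blast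

lemma quasigroup_right_division:
  assumes "quasigroup L" "a \<in> carrier L" "b \<in> carrier L"
  obtains y where "y \<in> carrier L" "y \<otimes>\<^bsub>L\<^esub> a = b"
  using ex1_implies_ex[OF quasigroup_ex1_right_division[OF assms]] by blast

lemma right_id_eq:
  assumes "quasigroup L" "right_identity L e"
  shows "right_id L = e"
  unfolding right_id_def
proof (rule the_equality)
  fix f assume "right_identity L f"
  with assms show "f = e"
    by - (rule quasigroup_left_cancel[OF assms(1), of e], auto simp: right_identity_def)
qed (fact assms(2))

lemma left_id_eq:
  assumes "quasigroup L" "left_identity L e"
  shows "left_id L = e"
  unfolding left_id_def
proof (rule the_equality)
  fix f assume "left_identity L f"
  with assms show "f = e"
    by - (rule quasigroup_right_cancel[OF assms(1), of e], auto simp: left_identity_def)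
qed (fact assms(2))

lemma right_inv_eq:
  assumes "quasigroup L" "right_identity L e"
    and "x \<in> carrier L" "x' \<in> carrier L" "x \<otimes>\<^bsub>L\<^esub> x' = e"
  shows "right_inv L x = x'"
  unfolding right_inv_def right_id_eq[OF assms(1,2)]
proof (rule the_equality)
  fix y assume "y \<in> carrier L \<and> x \<otimes>\<^bsub>L\<^esub> y = e"
  with assms show "y = x'"
    by - (rule quasigroup_left_cancel[OF assms(1,3)], auto)
qed (simp add: assms)

lemma left_inv_eq:
  assumes "quasigroup L" "left_identity L e"
    and "x \<in> carrier L" "x' \<in> carrier L" "x' \<otimes>\<^bsub>L\<^esub> x = e"
  shows "left_inv L x = x'"
  unfolding left_inv_def left_id_eq[OF assms(1,2)]
proof (rule the_equality)
  fix y assume "y \<in> carrier L \<and> y \<otimes>\<^bsub>L\<^esub> x = e"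
  with assms show "y = x'"
    by - (rule quasigroup_right_cancel[OF assms(1,3)], auto)
qed (simp add: assms)

lemma right_inv:
  assumes "quasigroup L" "right_identity L e" "x \<in> carrier L"
  shows "right_inv L x \<in> carrier L" "x \<otimes>\<^bsub>L\<^esub> right_inv L x = e"
proof -
  have "e \<in> carrier L" using assms(2) by (simp add: right_identity_def)
  with assms(1,3) obtain x' where x': "x' \<in> carrier L" "x \<otimes>\<^bsub>L\<^esub> x' = e"
    by (rule quasigroup_left_division)
  with right_inv_eq[OF assms x'] show "right_inv L x \<in> carrier L" "x \<otimes>\<^bsub>L\<^esub> right_inv L x = e"
    by auto
qed

lemma left_inv:
  assumes "quasigroup L" "left_identity L e" "x \<in> carrier L"
  shows "left_inv L x \<in> carrier L" "left_inv L x \<otimes>\<^bsub>L\<^esub> x = e"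
proof -
  have "e \<in> carrier L" using assms(2) by (simp add: left_identity_def)
  with assms(1,3) obtain x' where x': "x' \<in> carrier L" "x' \<otimes>\<^bsub>L\<^esub> x = e"
    by (rule quasigroup_right_division)
  with left_inv_eq[OF assms x'] show "left_inv L x \<in> carrier L" "left_inv L x \<otimes>\<^bsub>L\<^esub> x = e"
    by auto
qed

section \<open>Equivalence of the cross inverse identities\<close>

text \<open>
  Quantifying over the pairs \<open>x, x'\<close> with \<open>x x' = e\<close> instead of applying an inverse operation
  removes the difference between left and right inverses.
\<close>

definition cross_inverse_law :: "('a, 'b) monoid_scheme \<Rightarrow> bool" where
  "cross_inverse_law L \<longleftrightarrow> (\<exists>e. right_identity L e \<and> left_identity L e \<and>
     (\<forall>x\<in>carrier L. \<forall>x'\<in>carrier L. \<forall>y\<in>carrier L.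
        x \<otimes>\<^bsub>L\<^esub> x' = e \<longrightarrow> (x \<otimes>\<^bsub>L\<^esub> y) \<otimes>\<^bsub>L\<^esub> x' = y))"

text \<open>
  The identity \<open>(xy)x' = y\<close> says that left multiplication by \<open>x\<close> followed by right multiplication
  by \<open>x'\<close> is the identity map. Both are bijections, so they may be applied in the other order.
\<close>

lemma cross_inverse_pair_swap:
  assumes L: "quasigroup L" and x: "x \<in> carrier L" and x': "x' \<in> carrier L"
  shows "(\<forall>y\<in>carrier L. (x \<otimes>\<^bsub>L\<^esub> y) \<otimes>\<^bsub>L\<^esub> x' = y) \<longleftrightarrow> (\<forall>y\<in>carrier L. x \<otimes>\<^bsub>L\<^esub> (y \<otimes>\<^bsub>L\<^esub> x') = y)"
    (is "?A \<longleftrightarrow> ?B")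
proof (intro iffI ballI)
  fix y assume A: ?A and y: "y \<in> carrier L"
  obtain z where "z \<in> carrier L" "x \<otimes>\<^bsub>L\<^esub> z = y"
    using quasigroup_left_division[OF L x y] .
  with A show "x \<otimes>\<^bsub>L\<^esub> (y \<otimes>\<^bsub>L\<^esub> x') = y" by metis
next
  fix y assume B: ?B and y: "y \<in> carrier L"
  obtain z where "z \<in> carrier L" "z \<otimes>\<^bsub>L\<^esub> x' = y"
    using quasigroup_right_division[OF L x' y] .
  with B show "(x \<otimes>\<^bsub>L\<^esub> y) \<otimes>\<^bsub>L\<^esub> x' = y" by metis
qed

lemma cross_inverse_law_iff_swapped:
  assumes "quasigroup L"
  shows "cross_inverse_law L \<longleftrightarrow> (\<exists>e. right_identity L e \<and> left_identity L e \<and>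
     (\<forall>x\<in>carrier L. \<forall>x'\<in>carrier L. \<forall>y\<in>carrier L.
        x \<otimes>\<^bsub>L\<^esub> x' = e \<longrightarrow> x \<otimes>\<^bsub>L\<^esub> (y \<otimes>\<^bsub>L\<^esub> x') = y))"
  unfolding cross_inverse_law_def using cross_inverse_pair_swap[OF assms] by meson

text \<open>
  In each of the next four lemmas, the instance \<open>x = e\<close> of the identity, where the inverse of \<open>e\<close> is
  \<open>e\<close> itself, shows that the one-sided identity \<open>e\<close> is two-sided.
\<close>

lemma cross_inverse1_iff_law:
  assumes L: "quasigroup L"
  shows "cross_inverse1 L \<longleftrightarrow> cross_inverse_law L"
proof
  assume ci: "cross_inverse1 L"
  then obtain e where e: "right_identity L e" by (auto simp: cross_inverse1_def)
  have pair: "(x \<otimes>\<^bsub>L\<^esub> y) \<otimes>\<^bsub>L\<^esub> x' = y"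
    if "x \<in> carrier L" "x' \<in> carrier L" "y \<in> carrier L" "x \<otimes>\<^bsub>L\<^esub> x' = e" for x x' y
    using ci that right_inv_eq[OF L e that(1,2,4)] by (auto simp: cross_inverse1_def)
  have "left_identity L e"
    using e pair[of e e] quasigroup_closed[OF L] by (auto simp: left_identity_def right_identity_def)
  with e pair show "cross_inverse_law L" unfolding cross_inverse_law_def by blast
next
  assume "cross_inverse_law L"
  then show "cross_inverse1 L"
    unfolding cross_inverse_law_def cross_inverse1_def using right_inv[OF L] by blast
qed

lemma cross_inverse2_iff_law:
  assumes L: "quasigroup L"
  shows "cross_inverse2 L \<longleftrightarrow> cross_inverse_law L"
proof
  assume ci: "cross_inverse2 L"
  then obtain e where e: "right_identity L e" by (auto simp: cross_inverse2_def)
  have pair: "x \<otimes>\<^bsub>L\<^esub> (y \<otimes>\<^bsub>L\<^esub> x') = y"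
    if "x \<in> carrier L" "x' \<in> carrier L" "y \<in> carrier L" "x \<otimes>\<^bsub>L\<^esub> x' = e" for x x' y
    using ci that right_inv_eq[OF L e that(1,2,4)] by (auto simp: cross_inverse2_def)
  have "left_identity L e"
    using e pair[of e e] by (auto simp: left_identity_def right_identity_def)
  with e pair show "cross_inverse_law L" unfolding cross_inverse_law_iff_swapped[OF L] by blast
next
  assume "cross_inverse_law L"
  then show "cross_inverse2 L"
    unfolding cross_inverse_law_iff_swapped[OF L] cross_inverse2_def using right_inv[OF L] by blast
qed

lemma cross_inverse3_iff_law:
  assumes L: "quasigroup L"
  shows "cross_inverse3 L \<longleftrightarrow> cross_inverse_law L"
proof
  assume ci: "cross_inverse3 L"
  then obtain e where e: "left_identity L e" by (auto simp: cross_inverse3_def)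
  have pair: "x \<otimes>\<^bsub>L\<^esub> (y \<otimes>\<^bsub>L\<^esub> x') = y"
    if "x \<in> carrier L" "x' \<in> carrier L" "y \<in> carrier L" "x \<otimes>\<^bsub>L\<^esub> x' = e" for x x' y
    using ci that left_inv_eq[OF L e that(2,1,4)] by (auto simp: cross_inverse3_def)
  have "right_identity L e"
    using e pair[of e e] quasigroup_closed[OF L] by (auto simp: left_identity_def right_identity_def)
  with e pair show "cross_inverse_law L" unfolding cross_inverse_law_iff_swapped[OF L] by blast
next
  assume "cross_inverse_law L"
  then show "cross_inverse3 L"
    unfolding cross_inverse_law_iff_swapped[OF L] cross_inverse3_def using left_inv[OF L] by blast
qed

lemma cross_inverse4_iff_law:
  assumes L: "quasigroup L"
  shows "cross_inverse4 L \<longleftrightarrow> cross_inverse_law L"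
proof
  assume ci: "cross_inverse4 L"
  then obtain e where e: "left_identity L e" by (auto simp: cross_inverse4_def)
  have pair: "(x \<otimes>\<^bsub>L\<^esub> y) \<otimes>\<^bsub>L\<^esub> x' = y"
    if "x \<in> carrier L" "x' \<in> carrier L" "y \<in> carrier L" "x \<otimes>\<^bsub>L\<^esub> x' = e" for x x' y
    using ci that left_inv_eq[OF L e that(2,1,4)] by (auto simp: cross_inverse4_def)
  have "right_identity L e"
    using e pair[of e e] by (auto simp: left_identity_def right_identity_def)
  with e pair show "cross_inverse_law L" unfolding cross_inverse_law_def by blast
next
  assume "cross_inverse_law L"
  then show "cross_inverse4 L"
    unfolding cross_inverse_law_def cross_inverse4_def using left_inv[OF L] by blast
qed

lemmas cross_inverse_iff_law =
  cross_inverse1_iff_law cross_inverse2_iff_law cross_inverse3_iff_law cross_inverse4_iff_law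

lemma CIPQ_iff_law: "CIPQ L \<longleftrightarrow> quasigroup L \<and> cross_inverse_law L"
  by (auto simp: CIPQ_def cross_inverse_iff_law)

lemma CIPL_iff_law: "CIPL L \<longleftrightarrow> quasigroup L \<and> cross_inverse_law L"
  by (auto simp: CIPL_def quasigroup_loop_def cross_inverse_iff_law cross_inverse_law_def)

section \<open>The automorphism group and the holomorph\<close>

lemma carrier_AUM: "carrier (AUM L) = auto L"
  by (simp add: AUM_def AutoGroup_def)

lemma one_AUM: "\<one>\<^bsub>AUM L\<^esub> = (\<lambda>x\<in>carrier L. x)"
  by (simp add: AUM_def AutoGroup_def BijGroup_def)

lemma mult_AUM:
  assumes "\<alpha> \<in> carrier (AUM L)" "\<beta> \<in> carrier (AUM L)"
  shows "\<alpha> \<otimes>\<^bsub>AUM L\<^esub> \<beta> = compose (carrier L) \<beta> \<alpha>"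
  using assms by (simp add: carrier_AUM AUM_def AutoGroup_def BijGroup_def auto_def)

lemma one_AUM_apply [simp]: "x \<in> carrier L \<Longrightarrow> \<one>\<^bsub>AUM L\<^esub> x = x"
  by (simp add: one_AUM)

lemma one_AUM_closed:
  assumes "quasigroup L"
  shows "\<one>\<^bsub>AUM L\<^esub> \<in> carrier (AUM L)"
  using quasigroup_closed[OF assms]
  by (auto simp: carrier_AUM one_AUM auto_def hom_def Bij_def bij_betw_def inj_on_def)

lemma AUM_apply_closed: "\<alpha> \<in> carrier (AUM L) \<Longrightarrow> x \<in> carrier L \<Longrightarrow> \<alpha> x \<in> carrier L"
  by (auto simp: carrier_AUM auto_def hom_def)

lemma AUM_apply_mult:
  "\<alpha> \<in> carrier (AUM L) \<Longrightarrow> x \<in> carrier L \<Longrightarrow> y \<in> carrier L \<Longrightarrow>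
   \<alpha> (x \<otimes>\<^bsub>L\<^esub> y) = \<alpha> x \<otimes>\<^bsub>L\<^esub> \<alpha> y"
  by (auto simp: carrier_AUM auto_def hom_def)

lemma AUM_mult_one:
  assumes "quasigroup L" "\<alpha> \<in> carrier (AUM L)"
  shows "\<alpha> \<otimes>\<^bsub>AUM L\<^esub> \<one>\<^bsub>AUM L\<^esub> = \<alpha>" "\<one>\<^bsub>AUM L\<^esub> \<otimes>\<^bsub>AUM L\<^esub> \<alpha> = \<alpha>"
proof -
  have ext: "\<alpha> \<in> extensional (carrier L)" and maps: "\<alpha> \<in> carrier L \<rightarrow> carrier L"
    using assms(2) by (auto simp: carrier_AUM auto_def Bij_def hom_def)
  show "\<alpha> \<otimes>\<^bsub>AUM L\<^esub> \<one>\<^bsub>AUM L\<^esub> = \<alpha>"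
    unfolding mult_AUM[OF assms(2) one_AUM_closed[OF assms(1)]] unfolding one_AUM
    using Id_compose[OF maps ext] .
  show "\<one>\<^bsub>AUM L\<^esub> \<otimes>\<^bsub>AUM L\<^esub> \<alpha> = \<alpha>"
    unfolding mult_AUM[OF one_AUM_closed[OF assms(1)] assms(2)] unfolding one_AUM
    using compose_Id[OF maps ext] .
qed

lemma AUM_eq_one:
  assumes "\<alpha> \<in> carrier (AUM L)" "\<And>x. x \<in> carrier L \<Longrightarrow> \<alpha> x = x"
  shows "\<alpha> = \<one>\<^bsub>AUM L\<^esub>"
  using assms by (auto simp: carrier_AUM one_AUM auto_def Bij_def intro!: extensionalityI)

lemma AUM_trivialI:
  assumes "quasigroup L"
    and "\<And>\<alpha> x. \<alpha> \<in> carrier (AUM L) \<Longrightarrow> x \<in> carrier L \<Longrightarrow> \<alpha> x = x"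
  shows "carrier (AUM L) = {\<one>\<^bsub>AUM L\<^esub>}"
  using assms one_AUM_closed AUM_eq_one by blast

lemma trivial_AUM_comm_group:
  assumes "quasigroup L" "carrier (AUM L) = {\<one>\<^bsub>AUM L\<^esub>}"
  shows "comm_group (AUM L)"
  by (rule comm_groupI) (use assms(2) AUM_mult_one[OF assms(1) one_AUM_closed[OF assms(1)]] in auto)

lemma carrier_holomorph: "carrier (holomorph L) = carrier (AUM L) \<times> carrier L"
  by (simp add: holomorph_def)

lemma mult_holomorph:
  "(\<alpha>, x) \<otimes>\<^bsub>holomorph L\<^esub> (\<beta>, y) = (\<alpha> \<otimes>\<^bsub>AUM L\<^esub> \<beta>, \<beta> x \<otimes>\<^bsub>L\<^esub> y)"
  by (simp add: holomorph_def)

text \<open>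
  An identity element \<open>(\<epsilon>, e)\<close> of the holomorph acts on the elements \<open>(1, y)\<close>, which form a copy of
  \<open>L\<close>; hence \<open>\<epsilon> = 1\<close> and \<open>e\<close> is an identity of \<open>L\<close>. This copy also inherits the cross inverse law.
\<close>

lemma cross_inverse_law_holomorphD:
  assumes L: "quasigroup L" and H: "quasigroup (holomorph L)"
    and law: "cross_inverse_law (holomorph L)"
  shows "carrier (AUM L) = {\<one>\<^bsub>AUM L\<^esub>}" and "cross_inverse_law L"
proof -
  let ?H = "holomorph L" and ?i = "\<one>\<^bsub>AUM L\<^esub>"
  note i = one_AUM_closed[OF L]
  obtain \<epsilon> e where rid: "right_identity ?H (\<epsilon>, e)" and lid: "left_identity ?H (\<epsilon>, e)"
    and pair: "\<And>X X' Y. X \<in> carrier ?H \<Longrightarrow> X' \<in> carrier ?H \<Longrightarrow> Y \<in> carrier ?H \<Longrightarrow>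
      X \<otimes>\<^bsub>?H\<^esub> X' = (\<epsilon>, e) \<Longrightarrow> (X \<otimes>\<^bsub>?H\<^esub> Y) \<otimes>\<^bsub>?H\<^esub> X' = Y"
    using law unfolding cross_inverse_law_def by (metis surj_pair)
  have \<epsilon>: "\<epsilon> \<in> carrier (AUM L)" and e: "e \<in> carrier L"
    using rid by (auto simp: right_identity_def carrier_holomorph)
  have "(\<epsilon>, e) \<otimes>\<^bsub>?H\<^esub> (?i, y) = (?i, y)" if "y \<in> carrier L" for y
    using lid that i by (auto simp: left_identity_def carrier_holomorph)
  then have \<epsilon>_one: "\<epsilon> = ?i" and left: "\<And>y. y \<in> carrier L \<Longrightarrow> e \<otimes>\<^bsub>L\<^esub> y = y"
    using e \<epsilon> AUM_mult_one[OF L] by (auto simp: mult_holomorph)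
  have right: "y \<otimes>\<^bsub>L\<^esub> e = y" if "y \<in> carrier L" for y
  proof -
    have "(?i, y) \<otimes>\<^bsub>?H\<^esub> (\<epsilon>, e) = (?i, y)"
      using rid that i by (auto simp: right_identity_def carrier_holomorph)
    with that \<epsilon>_one show ?thesis by (auto simp: mult_holomorph)
  qed
  have "(x \<otimes>\<^bsub>L\<^esub> y) \<otimes>\<^bsub>L\<^esub> x' = y"
    if "x \<in> carrier L" "x' \<in> carrier L" "y \<in> carrier L" "x \<otimes>\<^bsub>L\<^esub> x' = e" for x x' y
    using pair[of "(?i, x)" "(?i, x')" "(?i, y)"] that i \<epsilon>_one quasigroup_closed[OF L]
    by (simp add: carrier_holomorph mult_holomorph AUM_mult_one[OF L])
  with e left right show "cross_inverse_law L"
    unfolding cross_inverse_law_def right_identity_def left_identity_def by blast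
  have fixes_e: "\<alpha> e = e" if \<alpha>: "\<alpha> \<in> carrier (AUM L)" for \<alpha>
  proof -
    have "\<alpha> e \<otimes>\<^bsub>L\<^esub> \<alpha> e = \<alpha> e \<otimes>\<^bsub>L\<^esub> e"
      using AUM_apply_mult[OF \<alpha> e e] right e AUM_apply_closed[OF \<alpha> e] by simp
    then show ?thesis
      by (rule quasigroup_left_cancel[OF L AUM_apply_closed[OF \<alpha> e] AUM_apply_closed[OF \<alpha> e] e])
  qed
  \<comment> \<open>The cross inverse identity at \<open>(\<alpha>, e)\<close> compares \<open>\<alpha>' y\<close> with \<open>y\<close>, where \<open>\<alpha>'\<close> is the inverse of \<open>\<alpha>\<close>.\<close>
  have "\<alpha> = ?i" if \<alpha>: "\<alpha> \<in> carrier (AUM L)" for \<alpha>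
  proof -
    obtain X where X: "X \<in> carrier ?H" "(\<alpha>, e) \<otimes>\<^bsub>?H\<^esub> X = (\<epsilon>, e)"
      using quasigroup_left_division[OF H, of "(\<alpha>, e)" "(\<epsilon>, e)"] \<alpha> \<epsilon> e
      by (auto simp: carrier_holomorph)
    obtain \<alpha>' z where Xeq: "X = (\<alpha>', z)" by (cases X)
    have \<alpha>': "\<alpha>' \<in> carrier (AUM L)" and z: "z \<in> carrier L"
      using X(1) Xeq by (auto simp: carrier_holomorph)
    have inverse: "\<alpha> \<otimes>\<^bsub>AUM L\<^esub> \<alpha>' = ?i" and "z = e"
      using X(2) Xeq fixes_e[OF \<alpha>'] left[OF z] \<epsilon>_one by (auto simp: mult_holomorph)
    have "\<alpha>' y = y" if y: "y \<in> carrier L" for y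
    proof -
      have "((\<alpha>, e) \<otimes>\<^bsub>?H\<^esub> (?i, y)) \<otimes>\<^bsub>?H\<^esub> X = (?i, y)"
        using pair[of "(\<alpha>, e)" X "(?i, y)"] X \<alpha> e i y by (simp add: carrier_holomorph)
      moreover have "(\<alpha>, e) \<otimes>\<^bsub>?H\<^esub> (?i, y) = (\<alpha>, y)"
        using e left[OF y] AUM_mult_one(1)[OF L \<alpha>] by (simp add: mult_holomorph)
      moreover have "(\<alpha>, y) \<otimes>\<^bsub>?H\<^esub> X = (?i, \<alpha>' y)"
        using Xeq \<open>z = e\<close> inverse right[OF AUM_apply_closed[OF \<alpha>' y]] by (simp add: mult_holomorph)
      ultimately show ?thesis by simp
    qed
    then have "\<alpha>' = ?i" by (rule AUM_eq_one[OF \<alpha>'])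
    with inverse AUM_mult_one[OF L \<alpha>] show ?thesis by simp
  qed
  with i show "carrier (AUM L) = {?i}" by blast
qed

lemma cross_inverse_law_holomorphI:
  assumes L: "quasigroup L" and triv: "carrier (AUM L) = {\<one>\<^bsub>AUM L\<^esub>}"
    and law: "cross_inverse_law L"
  shows "quasigroup (holomorph L)" and "cross_inverse_law (holomorph L)"
proof -
  let ?H = "holomorph L" and ?i = "\<one>\<^bsub>AUM L\<^esub>"
  have carrier: "carrier ?H = {?i} \<times> carrier L"
    by (simp add: carrier_holomorph triv)
  have mult: "(?i, x) \<otimes>\<^bsub>?H\<^esub> (?i, y) = (?i, x \<otimes>\<^bsub>L\<^esub> y)" if "x \<in> carrier L" for x y
    using that AUM_mult_one[OF L one_AUM_closed[OF L]] by (simp add: mult_holomorph)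
  show "quasigroup ?H"
    unfolding quasigroup_def
  proof (intro conjI ballI)
    show "carrier ?H \<noteq> {}"
      using L by (auto simp: carrier quasigroup_def)
  next
    fix A B assume "A \<in> carrier ?H" "B \<in> carrier ?H"
    then obtain a b where ab: "A = (?i, a)" "B = (?i, b)" "a \<in> carrier L" "b \<in> carrier L"
      by (auto simp: carrier)
    show "A \<otimes>\<^bsub>?H\<^esub> B \<in> carrier ?H"
      using ab quasigroup_closed[OF L] by (simp add: carrier mult)
    obtain x where x: "x \<in> carrier L" "a \<otimes>\<^bsub>L\<^esub> x = b"
      using quasigroup_left_division[OF L ab(3,4)] .
    then show "\<exists>!X. X \<in> carrier ?H \<and> A \<otimes>\<^bsub>?H\<^esub> X = B"
      using ab by (intro ex1I[of _ "(?i, x)"])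
        (auto simp: carrier mult dest: quasigroup_left_cancel[OF L ab(3) _ x(1)])
    obtain y where y: "y \<in> carrier L" "y \<otimes>\<^bsub>L\<^esub> a = b"
      using quasigroup_right_division[OF L ab(3,4)] .
    then show "\<exists>!Y. Y \<in> carrier ?H \<and> Y \<otimes>\<^bsub>?H\<^esub> A = B"
      using ab by (intro ex1I[of _ "(?i, y)"])
        (auto simp: carrier mult dest: quasigroup_right_cancel[OF L ab(3) _ y(1)])
  qed
  obtain e where e: "right_identity L e" "left_identity L e"
    and pair: "\<forall>x\<in>carrier L. \<forall>x'\<in>carrier L. \<forall>y\<in>carrier L.
      x \<otimes>\<^bsub>L\<^esub> x' = e \<longrightarrow> (x \<otimes>\<^bsub>L\<^esub> y) \<otimes>\<^bsub>L\<^esub> x' = y"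
    using law unfolding cross_inverse_law_def by blast
  have "right_identity ?H (?i, e)" "left_identity ?H (?i, e)"
    using e by (auto simp: right_identity_def left_identity_def carrier mult)
  with pair show "cross_inverse_law ?H"
    unfolding cross_inverse_law_def
    by (intro exI[of _ "(?i, e)"]) (auto simp: carrier mult quasigroup_closed[OF L])
qed

lemma CIPQ_holomorph_iff:
  assumes "quasigroup L"
  shows "CIPQ (holomorph L) \<longleftrightarrow> carrier (AUM L) = {\<one>\<^bsub>AUM L\<^esub>} \<and> cross_inverse_law L"
  using cross_inverse_law_holomorphD[OF assms] cross_inverse_law_holomorphI[OF assms]
  by (auto simp: CIPQ_iff_law)

section \<open>The conditions on the quasigroup\<close>

lemma holomorph_cond1_iff:
  assumes L: "quasigroup L"
  shows "comm_group (AUM L) \<and> holomorph_cond1 L \<longleftrightarrow>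
    carrier (AUM L) = {\<one>\<^bsub>AUM L\<^esub>} \<and> cross_inverse_law L"
proof (intro iffI conjI; elim conjE)
  assume cond: "holomorph_cond1 L"
  note i = one_AUM_closed[OF L]
  have "\<alpha> y = y" if "\<alpha> \<in> carrier (AUM L)" "y \<in> carrier L" for \<alpha> y
    using cond that i unfolding holomorph_cond1_def by (metis one_AUM_apply)
  with L show "carrier (AUM L) = {\<one>\<^bsub>AUM L\<^esub>}" by (rule AUM_trivialI)
  have "cross_inverse1 L"
    using cond i unfolding holomorph_cond1_def cross_inverse1_def by (metis one_AUM_apply)
  with L show "cross_inverse_law L" by (simp add: cross_inverse1_iff_law)
next
  assume triv: "carrier (AUM L) = {\<one>\<^bsub>AUM L\<^esub>}" and law: "cross_inverse_law L"
  from L triv show "comm_group (AUM L)" by (rule trivial_AUM_comm_group)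
  from law have "cross_inverse1 L" using L by (simp add: cross_inverse1_iff_law)
  with triv show "holomorph_cond1 L" by (simp add: holomorph_cond1_def cross_inverse1_def)
qed

lemma holomorph_cond2_iff:
  assumes L: "quasigroup L"
  shows "comm_group (AUM L) \<and> holomorph_cond2 L \<longleftrightarrow>
    carrier (AUM L) = {\<one>\<^bsub>AUM L\<^esub>} \<and> cross_inverse_law L"
proof (intro iffI conjI; elim conjE)
  assume cond: "holomorph_cond2 L"
  note i = one_AUM_closed[OF L]
  have "\<alpha> y = y" if "\<alpha> \<in> carrier (AUM L)" "y \<in> carrier L" for \<alpha> y
    using cond that i unfolding holomorph_cond2_def by (metis one_AUM_apply)
  with L show "carrier (AUM L) = {\<one>\<^bsub>AUM L\<^esub>}" by (rule AUM_trivialI)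
  have "cross_inverse2 L"
    using cond i unfolding holomorph_cond2_def cross_inverse2_def by (metis one_AUM_apply)
  with L show "cross_inverse_law L" by (simp add: cross_inverse2_iff_law)
next
  assume triv: "carrier (AUM L) = {\<one>\<^bsub>AUM L\<^esub>}" and law: "cross_inverse_law L"
  from L triv show "comm_group (AUM L)" by (rule trivial_AUM_comm_group)
  from law have "cross_inverse2 L" using L by (simp add: cross_inverse2_iff_law)
  with triv show "holomorph_cond2 L" by (simp add: holomorph_cond2_def cross_inverse2_def)
qed

lemma inv_AUM_one:
  assumes "comm_group (AUM L)"
  shows "inv\<^bsub>AUM L\<^esub> \<one>\<^bsub>AUM L\<^esub> = \<one>\<^bsub>AUM L\<^esub>"
proof -
  interpret comm_group "AUM L" by (fact assms)
  show ?thesis by (rule inv_one)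
qed

text \<open>
  The last two conditions constrain automorphisms only on left inverses. That suffices, because
  every \<open>u\<close> is the left inverse of the solution \<open>x\<close> of \<open>u x = e\<close>.
\<close>

lemma AUM_trivial_if_fixes_left_inverses:
  assumes L: "quasigroup L" and "\<exists>e. left_identity L e"
    and fixed: "\<And>\<beta> x. \<beta> \<in> carrier (AUM L) \<Longrightarrow> x \<in> carrier L \<Longrightarrow>
      \<beta> (left_inv L x) = left_inv L x"
  shows "carrier (AUM L) = {\<one>\<^bsub>AUM L\<^esub>}"
proof (rule AUM_trivialI[OF L])
  fix \<beta> u assume \<beta>: "\<beta> \<in> carrier (AUM L)" and u: "u \<in> carrier L"
  obtain e where e: "left_identity L e" using assms(2) ..
  then have "e \<in> carrier L" by (simp add: left_identity_def)
  then obtain x where x: "x \<in> carrier L" "u \<otimes>\<^bsub>L\<^esub> x = e"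
    using quasigroup_left_division[OF L u] by blast
  show "\<beta> u = u"
    using fixed[OF \<beta> x(1)] left_inv_eq[OF L e x(1) u x(2)] by simp
qed

lemma holomorph_cond3_iff:
  assumes L: "quasigroup L"
  shows "comm_group (AUM L) \<and> holomorph_cond3 L \<longleftrightarrow>
    carrier (AUM L) = {\<one>\<^bsub>AUM L\<^esub>} \<and> cross_inverse_law L"
proof (intro iffI; elim conjE)
  assume comm: "comm_group (AUM L)" and cond: "holomorph_cond3 L"
  note i = one_AUM_closed[OF L]
  obtain e where e: "left_identity L e"
    using cond by (auto simp: holomorph_cond3_def)
  note inv_closed = left_inv(1)[OF L e]
  have eq: "(\<beta> (left_inv L x) \<otimes>\<^bsub>L\<^esub> y) \<otimes>\<^bsub>L\<^esub> x = y"
    if "\<beta> \<in> carrier (AUM L)" "x \<in> carrier L" "y \<in> carrier L" for \<beta> x y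
  proof -
    have "(\<one>\<^bsub>AUM L\<^esub> (\<beta> ((inv\<^bsub>AUM L\<^esub> \<one>\<^bsub>AUM L\<^esub>) (left_inv L x))) \<otimes>\<^bsub>L\<^esub> \<one>\<^bsub>AUM L\<^esub> y) \<otimes>\<^bsub>L\<^esub> x = y"
      using cond that i unfolding holomorph_cond3_def by blast
    then show ?thesis
      using that inv_closed[OF that(2)] AUM_apply_closed[OF that(1) inv_closed[OF that(2)]]
      by (simp add: inv_AUM_one[OF comm])
  qed
  have ci: "(left_inv L x \<otimes>\<^bsub>L\<^esub> y) \<otimes>\<^bsub>L\<^esub> x = y" if "x \<in> carrier L" "y \<in> carrier L" for x y
    using eq[OF i that] inv_closed[OF that(1)] by simp
  have "\<beta> (left_inv L x) = left_inv L x" if \<beta>: "\<beta> \<in> carrier (AUM L)" and x: "x \<in> carrier L" for \<beta> x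
  proof -
    \<comment> \<open>Any \<open>y\<close> would do here; \<open>y = x\<close> is at hand.\<close>
    note c = AUM_apply_closed[OF \<beta> inv_closed[OF x]] inv_closed[OF x]
    have "\<beta> (left_inv L x) \<otimes>\<^bsub>L\<^esub> x = left_inv L x \<otimes>\<^bsub>L\<^esub> x"
      using eq[OF \<beta> x x] ci[OF x x] quasigroup_closed[OF L] c x
      by - (rule quasigroup_right_cancel[OF L x], auto)
    then show ?thesis by (rule quasigroup_right_cancel[OF L x c])
  qed
  then have "carrier (AUM L) = {\<one>\<^bsub>AUM L\<^esub>}"
    using AUM_trivial_if_fixes_left_inverses[OF L] e by blast
  moreover have "cross_inverse4 L" using ci e by (auto simp: cross_inverse4_def)
  ultimately show "carrier (AUM L) = {\<one>\<^bsub>AUM L\<^esub>} \<and> cross_inverse_law L"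
    using L by (simp add: cross_inverse4_iff_law)
next
  assume triv: "carrier (AUM L) = {\<one>\<^bsub>AUM L\<^esub>}" and law: "cross_inverse_law L"
  have comm: "comm_group (AUM L)" using L triv by (rule trivial_AUM_comm_group)
  from law have "cross_inverse4 L" using L by (simp add: cross_inverse4_iff_law)
  then have "holomorph_cond3 L"
    using left_inv(1)[OF L]
    by (auto simp: holomorph_cond3_def cross_inverse4_def triv inv_AUM_one[OF comm])
  with comm show "comm_group (AUM L) \<and> holomorph_cond3 L" ..
qed

lemma holomorph_cond4_iff:
  assumes L: "quasigroup L"
  shows "comm_group (AUM L) \<and> holomorph_cond4 L \<longleftrightarrow>
    carrier (AUM L) = {\<one>\<^bsub>AUM L\<^esub>} \<and> cross_inverse_law L"
proof (intro iffI; elim conjE)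
  assume comm: "comm_group (AUM L)" and cond: "holomorph_cond4 L"
  note i = one_AUM_closed[OF L]
  obtain e where e: "left_identity L e"
    using cond by (auto simp: holomorph_cond4_def)
  note inv_closed = left_inv(1)[OF L e]
  have eq: "\<beta> (left_inv L x) \<otimes>\<^bsub>L\<^esub> (y \<otimes>\<^bsub>L\<^esub> x) = y"
    if "\<beta> \<in> carrier (AUM L)" "x \<in> carrier L" "y \<in> carrier L" for \<beta> x y
  proof -
    have "\<one>\<^bsub>AUM L\<^esub> (\<beta> ((inv\<^bsub>AUM L\<^esub> \<one>\<^bsub>AUM L\<^esub>) (left_inv L x))) \<otimes>\<^bsub>L\<^esub> (\<one>\<^bsub>AUM L\<^esub> y \<otimes>\<^bsub>L\<^esub> x) = y"
      using cond that i unfolding holomorph_cond4_def by blast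
    then show ?thesis
      using that inv_closed[OF that(2)] AUM_apply_closed[OF that(1) inv_closed[OF that(2)]]
      by (simp add: inv_AUM_one[OF comm])
  qed
  have ci: "left_inv L x \<otimes>\<^bsub>L\<^esub> (y \<otimes>\<^bsub>L\<^esub> x) = y" if "x \<in> carrier L" "y \<in> carrier L" for x y
    using eq[OF i that] inv_closed[OF that(1)] by simp
  have "\<beta> (left_inv L x) = left_inv L x" if \<beta>: "\<beta> \<in> carrier (AUM L)" and x: "x \<in> carrier L" for \<beta> x
    using eq[OF \<beta> x x] ci[OF x x] inv_closed[OF x] AUM_apply_closed[OF \<beta> inv_closed[OF x]]
    by - (rule quasigroup_right_cancel[OF L quasigroup_closed[OF L x x]], auto)
  then have "carrier (AUM L) = {\<one>\<^bsub>AUM L\<^esub>}"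
    using AUM_trivial_if_fixes_left_inverses[OF L] e by blast
  moreover have "cross_inverse3 L" using ci e by (auto simp: cross_inverse3_def)
  ultimately show "carrier (AUM L) = {\<one>\<^bsub>AUM L\<^esub>} \<and> cross_inverse_law L"
    using L by (simp add: cross_inverse3_iff_law)
next
  assume triv: "carrier (AUM L) = {\<one>\<^bsub>AUM L\<^esub>}" and law: "cross_inverse_law L"
  have comm: "comm_group (AUM L)" using L triv by (rule trivial_AUM_comm_group)
  from law have "cross_inverse3 L" using L by (simp add: cross_inverse3_iff_law)
  then have "holomorph_cond4 L"
    using left_inv(1)[OF L]
    by (auto simp: holomorph_cond4_def cross_inverse3_def triv inv_AUM_one[OF comm])
  with comm show "comm_group (AUM L) \<and> holomorph_cond4 L" ..
qed

theorem theorem2p3: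
  fixes L :: "('a, 'b) monoid_scheme"
  shows "(quasigroup L \<longrightarrow>
            (CIPQ (holomorph L) \<longleftrightarrow> comm_group (AUM L) \<and> holomorph_cond1 L) \<and>
            (CIPQ (holomorph L) \<longleftrightarrow> comm_group (AUM L) \<and> holomorph_cond2 L) \<and>
            (CIPQ (holomorph L) \<longleftrightarrow> comm_group (AUM L) \<and> holomorph_cond3 L) \<and>
            (CIPQ (holomorph L) \<longleftrightarrow> comm_group (AUM L) \<and> holomorph_cond4 L)) \<and>
         (quasigroup_loop L \<longrightarrow>
            (CIPL (holomorph L) \<longleftrightarrow> comm_group (AUM L) \<and> holomorph_cond1 L) \<and>
            (CIPL (holomorph L) \<longleftrightarrow> comm_group (AUM L) \<and> holomorph_cond2 L) \<and>
            (CIPL (holomorph L) \<longleftrightarrow> comm_group (AUM L) \<and> holomorph_cond3 L) \<and>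
            (CIPL (holomorph L) \<longleftrightarrow> comm_group (AUM L) \<and> holomorph_cond4 L))"
  unfolding quasigroup_loop_def CIPL_iff_law CIPQ_iff_law[symmetric]
  using CIPQ_holomorph_iff holomorph_cond1_iff holomorph_cond2_iff holomorph_cond3_iff
    holomorph_cond4_iff
  by metis

end
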